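(* Let $n\ge 2$ and let $B=(b_{ij})$ be a real $n\times n$ matrix all of whose principal minors are nonzero. Then for every $m\in\{1,\dots,n\}$, $$\frac{b_{m\cdot}\bigl(B(m|m)\bigr)^{-1}b_{\cdot m}}{b_{mm}-b_{m\cdot}\bigl(B(m|m)\bigr)^{-1}b_{\cdot m}}=\sum_{l\neq m}\frac{b_{lm}\,f_{ml}\bigl(B(l|l)\bigr)^{-1}b_{\cdot l}}{b_{ll}-b_{l\cdot}\bigl(B(l|l)\bigr)^{-1}b_{\cdot l}},$$ where the sum is over $l\in\{1,\dots,n\}\setminus\{m\}$, and for all $l,m\in\{1,\dots,n\}$ with $l\neq m$, $$-\frac{b_{mm}\,f_{lm}\bigl(B(m|m)\bigr)^{-1}b_{\cdot m}}{b_{mm}-b_{m\cdot}\bigl(B(m|m)\bigr)^{-1}b_{\cdot m}}=-\frac{b_{lm}}{b_{ll}-b_{l\cdot}\bigl(B(l|l)\bigr)^{-1}b_{\cdot l}}+\sum_{\substack{k\neq l,\\ k\neq m}}\frac{b_{km}\,f_{lk}\bigl(B(k|k)\bigr)^{-1}b_{\cdot k}}{b_{kk}-b_{k\cdot}\bigl(B(k|k)\bigr)^{-1}b_{\cdot k}},$$ where the sum is over $k\in\{1,\dots,n\}\setminus\{l,m\}$.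
   Context: A principal minor of $B$ is the determinant of a submatrix obtained by keeping the rows and columns indexed by the same nonempty subset of $\{1,\dots,n\}$ (this includes $\det B$ itself). $B(i|j)$ denotes the matrix obtained from $B$ by deleting the $i$th row and the $j$th column. $b_{\cdot l}$ denotes the $l$th column of $B$ with its $l$th entry deleted (a column vector of length $n-1$), and $b_{l\cdot}$ denotes the $l$th row of $B$ with its $l$th entry deleted (a row vector of length $n-1$). Let $e_i$ be the $i$th element of the standard basis of $\mathbb{R}^{n-1}$ (a column vector). For $m\neq l$ in $\{1,\dots,n\}$, $f_{ml}$ is the row vector of length $n-1$ given by $f_{ml}=e_m^T$ if $m<l$ and $f_{ml}=e_{m-1}^T$ if $m>l$. *)

theory Defs
  imports
    "Jordan_Normal_Form.Determinant"
    "Jordan_Normal_Form.Gauss_Jordan_Elimination"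
    "Jordan_Normal_Form.DL_Submatrix"
begin

(* Rows, columns and entries are numbered 0, ..., n-1. Vectors carry no row/column
   orientation: a row vector times a column vector is the scalar product. *)

definition vec_delete :: "'a vec \<Rightarrow> nat \<Rightarrow> 'a vec" where
  "vec_delete v l = vec (dim_vec v - 1) (\<lambda>i. v $ (if i < l then i else Suc i))"

definition del_col :: "'a mat \<Rightarrow> nat \<Rightarrow> 'a vec" where
  "del_col B l = vec_delete (col B l) l"

definition del_row :: "'a mat \<Rightarrow> nat \<Rightarrow> 'a vec" where
  "del_row B l = vec_delete (row B l) l"

(* The standard basis vector of length n - 1 whose 1 sits where index m ends up
   once index l is deleted; meaningful only for m \<noteq> l. *)
definition del_unit_vec :: "nat \<Rightarrow> nat \<Rightarrow> nat \<Rightarrow> 'a :: zero_neq_one vec" where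
  "del_unit_vec n m l = unit_vec (n - 1) (if m < l then m else m - 1)"

(* Unspecified if B(l|l) is singular, which nonvanishing principal minors rule out. *)
definition del_inverse :: "'a :: field mat \<Rightarrow> nat \<Rightarrow> 'a mat" where
  "del_inverse B l = the (mat_inverse (mat_delete B l l))"

(* The Schur complement of B(l|l) in B. *)
definition schur_del :: "'a :: field mat \<Rightarrow> nat \<Rightarrow> 'a" where
  "schur_del B l = B $$ (l, l) - del_row B l \<bullet> (del_inverse B l *\<^sub>v del_col B l)"

lemma del_inverse:
  fixes B :: "'a :: field mat"
  assumes B: "B \<in> carrier_mat n n" and det: "det (mat_delete B l l) \<noteq> 0"
  shows "del_inverse B l \<in> carrier_mat (n - 1) (n - 1)"
    and "mat_delete B l l * del_inverse B l = 1\<^sub>m (n - 1)"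
    and "del_inverse B l * mat_delete B l l = 1\<^sub>m (n - 1)"
proof -
  have A: "mat_delete B l l \<in> carrier_mat (n - 1) (n - 1)"
    using B by (auto simp: mat_delete_def)
  have "mat_delete B l l \<in> Units (ring_mat TYPE('a) (n - 1) ())"
    using A det by (rule det_non_zero_imp_unit)
  then obtain C where "mat_inverse (mat_delete B l l) = Some C"
    using mat_inverse(1)[OF A, of "()"] by (cases "mat_inverse (mat_delete B l l)") auto
  then show "del_inverse B l \<in> carrier_mat (n - 1) (n - 1)"
    and "mat_delete B l l * del_inverse B l = 1\<^sub>m (n - 1)"
    and "del_inverse B l * mat_delete B l l = 1\<^sub>m (n - 1)"
    using mat_inverse(2)[OF A] by (auto simp: del_inverse_def)
qed

end

theory Submission
  imports Defs
begin

text \<open>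
  Both identities are the entries of the matrix equation \<open>C B = 1\<close> for \<open>C = B\<^sup>-\<^sup>1\<close>, written with the
  block inversion formula.

  Eliminating all unknowns but the one with index \<open>l\<close> solves \<open>B v = s\<^sub>l e\<^sub>l\<close>, where \<open>s\<^sub>l\<close> is the Schur
  complement of \<open>B(l|l)\<close>: the vector \<open>v\<close> has entry \<open>1\<close> at \<open>l\<close> and its other entries are those of
  \<open>- B(l|l)\<^sup>-\<^sup>1 b\<^sub>l\<close>, with \<open>b\<^sub>l\<close> the \<open>l\<close>th column without its \<open>l\<close>th entry (lemma \<open>mult_elim_vec\<close>).
  Since \<open>v \<noteq> 0\<close> and \<open>B\<close> is nonsingular, \<open>s\<^sub>l \<noteq> 0\<close>, and \<open>v / s\<^sub>l\<close> is column \<open>l\<close> of \<open>C\<close>. So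
  \<open>C\<^sub>l\<^sub>l = 1 / s\<^sub>l\<close>, and each term of the two sums is \<open>- C\<^sub>m\<^sub>l b\<^sub>l\<^sub>m\<close> (in the second one, with other
  names for the indices).

  A right inverse of a square matrix is a left inverse, so \<open>C B = 1\<close>. Its entry \<open>(m, m)\<close> is the first
  identity, because the fraction on its left is \<open>(b\<^sub>m\<^sub>m - s\<^sub>m) / s\<^sub>m = b\<^sub>m\<^sub>m C\<^sub>m\<^sub>m - 1\<close>. Its entry \<open>(l, m)\<close>
  with \<open>l \<noteq> m\<close> is the second identity, with the summands for the indices \<open>l\<close> and \<open>m\<close> split off.
\<close>

lemma pick_atLeastLessThan:
  assumes "i < n"
  shows "pick {0..<n} i = i"
proof -
  have "{a \<in> {0..<n}. a < i} = {0..<i}"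
    using assms by auto
  with pick_card_in_set[of i "{0..<n}"] assms show ?thesis
    by simp
qed

lemma pick_remove_index:
  assumes l: "l < n" and i: "i < n - 1"
  shows "pick ({0..<n} - {l}) i = insert_index l i"
proof -
  let ?I = "{0..<n} - {l}"
  have I: "insert_index l i \<in> ?I"
    using l i by (auto simp: insert_index_def)
  have "{a \<in> ?I. a < insert_index l i} = insert_index l ` {0..<i}"
  proof (intro equalityI subsetI)
    fix a assume a: "a \<in> {a \<in> ?I. a < insert_index l i}"
    then have "delete_index l a < i"
      by (auto simp: insert_index_def delete_index_def split: if_splits)
    then show "a \<in> insert_index l ` {0..<i}"
      using a insert_delete_index[of a l] by (metis DiffD2 atLeastLessThan_iff imageI insertI1
          mem_Collect_eq zero_le)
  next
    fix a assume "a \<in> insert_index l ` {0..<i}"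
    then show "a \<in> {a \<in> ?I. a < insert_index l i}"
      using l i by (auto simp: insert_index_def)
  qed
  then have "card {a \<in> ?I. a < insert_index l i} = i"
    by (simp add: card_image insert_index_inj_on)
  with pick_card_in_set[OF I] show ?thesis
    by simp
qed

lemma submatrix_full:
  assumes "B \<in> carrier_mat n n"
  shows "submatrix B {0..<n} {0..<n} = B"
proof -
  have "{i. i < n \<and> i \<in> {0..<n}} = {0..<n}"
    by auto
  with assms show ?thesis
    by (intro eq_matI) (auto simp: submatrix_def pick_atLeastLessThan)
qed

lemma submatrix_remove_index:
  assumes B: "B \<in> carrier_mat n n" and l: "l < n"
  shows "submatrix B ({0..<n} - {l}) ({0..<n} - {l}) = mat_delete B l l"
proof -
  have "{i. i < n \<and> i \<in> {0..<n} - {l}} = {0..<n} - {l}"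
    by auto
  then have "card {i. i < n \<and> i \<in> {0..<n} - {l}} = n - 1"
    using l by simp
  with B l show ?thesis
    by (intro eq_matI)
      (auto simp: submatrix_def mat_delete_def pick_remove_index insert_index_def)
qed

lemma sum_insert_index:
  fixes f :: "nat \<Rightarrow> 'a :: comm_monoid_add"
  assumes l: "l < n"
  shows "(\<Sum>j \<in> {0..<n}. f j) = f l + (\<Sum>i \<in> {0..<n - 1}. f (insert_index l i))"
proof -
  have "insert_index l ` {0..<n - 1} = {0..<n} - {l}"
    using insert_index_image[of l "n - 1"] l by simp
  then have "(\<Sum>j \<in> {0..<n} - {l}. f j) = (\<Sum>i \<in> {0..<n - 1}. f (insert_index l i))"
    using sum.reindex[OF insert_index_inj_on, of f l "{0..<n - 1}"] by simp
  then show ?thesis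
    using l by (simp add: sum.remove)
qed

text \<open>Back substitution: the solution of all equations \<open>(B v)\<^sub>i = 0\<close> with \<open>i \<noteq> l\<close> that has \<open>v\<^sub>l = 1\<close>.
  The scalar product with \<open>del_unit_vec\<close> reads off an entry of the reduced solution at its shifted
  position, in the form in which the identities use it.\<close>

definition elim_vec :: "'a :: field mat \<Rightarrow> nat \<Rightarrow> 'a vec" where
  "elim_vec B l = vec (dim_row B) (\<lambda>j. if j = l then 1
     else - (del_unit_vec (dim_row B) j l \<bullet> (del_inverse B l *\<^sub>v del_col B l)))"

lemma elim_vec_insert_index:
  fixes B :: "'a :: field mat"
  assumes B: "B \<in> carrier_mat n n" and det: "det (mat_delete B l l) \<noteq> 0"
    and l: "l < n" and i: "i < n - 1"
  shows "elim_vec B l $ insert_index l i = - (del_inverse B l *\<^sub>v del_col B l) $ i"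
proof -
  have w: "del_inverse B l *\<^sub>v del_col B l \<in> carrier_vec (n - 1)"
    using del_inverse(1)[OF B det] by (intro carrier_vecI) simp
  have "insert_index l i < n"
    using l i unfolding insert_index_def by auto
  moreover have "del_unit_vec n (insert_index l i) l = (unit_vec (n - 1) i :: 'a vec)"
    by (simp add: del_unit_vec_def insert_index_def)
  ultimately show ?thesis
    using B w i by (simp add: elim_vec_def)
qed

text \<open>The rows other than \<open>l\<close> vanish because \<open>B(l|l)\<close> times the reduced solution is the reduced
  column; what is left in row \<open>l\<close> is the Schur complement by its definition.\<close>

lemma mult_elim_vec:
  fixes B :: "'a :: field mat"
  assumes B: "B \<in> carrier_mat n n" and det: "det (mat_delete B l l) \<noteq> 0" and l: "l < n"
  shows "B *\<^sub>v elim_vec B l = schur_del B l \<cdot>\<^sub>v unit_vec n l"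
proof (rule eq_vecI)
  define w where "w = del_inverse B l *\<^sub>v del_col B l"
  have D: "del_inverse B l \<in> carrier_mat (n - 1) (n - 1)"
    using del_inverse(1)[OF B det] .
  have M: "mat_delete B l l \<in> carrier_mat (n - 1) (n - 1)"
    using B by (auto simp: mat_delete_def)
  have c: "del_col B l \<in> carrier_vec (n - 1)"
    using B by (intro carrier_vecI) (simp add: del_col_def vec_delete_def)
  have w: "w \<in> carrier_vec (n - 1)"
    using D by (intro carrier_vecI) (simp add: w_def)
  have Mw: "mat_delete B l l *\<^sub>v w = del_col B l"
    unfolding w_def using assoc_mult_mat_vec[OF M D c] del_inverse(2)[OF B det] c by simp
  have row: "(B *\<^sub>v elim_vec B l) $ i =
      B $$ (i, l) - (\<Sum>k \<in> {0..<n - 1}. B $$ (i, insert_index l k) * w $ k)" if i: "i < n" for i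
  proof -
    have "(B *\<^sub>v elim_vec B l) $ i = (\<Sum>j \<in> {0..<n}. B $$ (i, j) * elim_vec B l $ j)"
      using B i by (simp add: scalar_prod_def elim_vec_def)
    also have "\<dots> = B $$ (i, l) * elim_vec B l $ l
        + (\<Sum>k \<in> {0..<n - 1}. B $$ (i, insert_index l k) * elim_vec B l $ insert_index l k)"
      by (rule sum_insert_index[OF l])
    also have "elim_vec B l $ l = 1"
      using B l by (simp add: elim_vec_def)
    also have "(\<Sum>k \<in> {0..<n - 1}. B $$ (i, insert_index l k) * elim_vec B l $ insert_index l k)
        = (\<Sum>k \<in> {0..<n - 1}. - (B $$ (i, insert_index l k) * w $ k))"
      by (rule sum.cong) (simp_all add: elim_vec_insert_index[OF B det l] w_def)
    finally show ?thesis
      by (simp add: sum_negf)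
  qed
  fix i assume "i < dim_vec (schur_del B l \<cdot>\<^sub>v unit_vec n l)"
  then have i: "i < n" by simp
  show "(B *\<^sub>v elim_vec B l) $ i = (schur_del B l \<cdot>\<^sub>v unit_vec n l) $ i"
  proof (cases "i = l")
    case True
    have "del_row B l \<bullet> w = (\<Sum>k \<in> {0..<n - 1}. B $$ (l, insert_index l k) * w $ k)"
      using B l w by (auto simp: scalar_prod_def del_row_def vec_delete_def insert_index_def
          intro!: sum.cong)
    then show ?thesis
      using True row[OF l] l by (simp add: schur_del_def w_def)
  next
    case False
    define i' where "i' = delete_index l i"
    have ii': "insert_index l i' = i" and i': "i' < n - 1"
      using False i l by (auto simp: i'_def insert_delete_index delete_index_def)
    have "(mat_delete B l l *\<^sub>v w) $ i' = (\<Sum>k \<in> {0..<n - 1}. B $$ (i, insert_index l k) * w $ k)"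
      using M B w i' ii' by (auto simp: scalar_prod_def mat_delete_def insert_index_def
          intro!: sum.cong)
    moreover have "del_col B l $ i' = B $$ (i, l)"
      using B i l i' ii' by (auto simp: del_col_def vec_delete_def insert_index_def)
    ultimately show ?thesis
      using row[OF i] Mw False i l by simp
  qed
qed (use B in simp)

lemma schur_del_nonzero:
  fixes B :: "'a :: field mat"
  assumes B: "B \<in> carrier_mat n n" and detB: "det B \<noteq> 0"
    and det: "det (mat_delete B l l) \<noteq> 0" and l: "l < n"
  shows "schur_del B l \<noteq> 0"
proof
  assume "schur_del B l = 0"
  then have "B *\<^sub>v elim_vec B l = 0\<^sub>v n"
    using mult_elim_vec[OF B det l] by auto
  moreover have "elim_vec B l \<in> carrier_vec n"
    using B by (intro carrier_vecI) (simp add: elim_vec_def)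
  moreover have "elim_vec B l $ l \<noteq> 0\<^sub>v n $ l"
    using B l by (simp add: elim_vec_def)
  ultimately show False
    using det_0_iff_vec_prod_zero_field[OF B] detB by metis
qed

text \<open>The entries of \<open>C B = 1\<close>, where \<open>C\<close> is assembled from the normalised columns
  \<open>v / s\<^sub>k\<close> and therefore satisfies \<open>B C = 1\<close>.\<close>

lemma left_inverse_entries:
  fixes B :: "'a :: field mat"
  assumes B: "B \<in> carrier_mat n n" and detB: "det B \<noteq> 0"
    and det: "\<And>k. k < n \<Longrightarrow> det (mat_delete B k k) \<noteq> 0"
    and l: "l < n" and m: "m < n"
  shows "(\<Sum>k \<in> {0..<n}. elim_vec B k $ l / schur_del B k * B $$ (k, m)) = (if l = m then 1 else 0)"
proof -
  define C where "C = mat n n (\<lambda>(i, k). elim_vec B k $ i / schur_del B k)"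
  have C: "C \<in> carrier_mat n n"
    by (simp add: C_def)
  have "B * C = 1\<^sub>m n"
  proof (rule eq_matI)
    fix i k assume "i < dim_row (1\<^sub>m n :: 'a mat)" "k < dim_col (1\<^sub>m n :: 'a mat)"
    then have i: "i < n" and k: "k < n" by simp_all
    have "(B * C) $$ (i, k) = (\<Sum>j \<in> {0..<n}. B $$ (i, j) * (elim_vec B k $ j / schur_del B k))"
      using B i k by (simp add: C_def scalar_prod_def)
    also have "\<dots> = (B *\<^sub>v elim_vec B k) $ i / schur_del B k"
      using B i k by (simp add: scalar_prod_def elim_vec_def sum_divide_distrib)
    also have "\<dots> = 1\<^sub>m n $$ (i, k)"
      using mult_elim_vec[OF B det[OF k] k] schur_del_nonzero[OF B detB det[OF k] k] i k by auto
    finally show "(B * C) $$ (i, k) = 1\<^sub>m n $$ (i, k)" .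
  qed (use B C in auto)
  then have "C * B = 1\<^sub>m n"
    by (rule mat_mult_left_right_inverse[OF B C])
  then have "(C * B) $$ (l, m) = (if l = m then 1 else 0)"
    using l m by simp
  moreover have "(C * B) $$ (l, m) =
      (\<Sum>k \<in> {0..<n}. elim_vec B k $ l / schur_del B k * B $$ (k, m))"
    using B l m by (simp add: C_def scalar_prod_def)
  ultimately show ?thesis by simp
qed

theorem theorem3:
  fixes B :: "real mat" and n :: nat
  assumes "n \<ge> 2"
    and "B \<in> carrier_mat n n"
    and "\<And>I. I \<subseteq> {0..<n} \<Longrightarrow> I \<noteq> {} \<Longrightarrow> det (submatrix B I I) \<noteq> 0"
  shows "(\<forall>m < n.
      (del_row B m \<bullet> (del_inverse B m *\<^sub>v del_col B m)) / schur_del B m =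
      (\<Sum>l \<in> {0..<n} - {m}.
        (B $$ (l, m) * (del_unit_vec n m l \<bullet> (del_inverse B l *\<^sub>v del_col B l))) / schur_del B l))
    \<and> (\<forall>l < n. \<forall>m < n. l \<noteq> m \<longrightarrow>
      - ((B $$ (m, m) * (del_unit_vec n l m \<bullet> (del_inverse B m *\<^sub>v del_col B m))) / schur_del B m) =
      - (B $$ (l, m) / schur_del B l) +
      (\<Sum>k \<in> {0..<n} - {l, m}.
        (B $$ (k, m) * (del_unit_vec n l k \<bullet> (del_inverse B k *\<^sub>v del_col B k))) / schur_del B k))"
proof -
  note B = assms(2)
  define q where "q l k = del_unit_vec n l k \<bullet> (del_inverse B k *\<^sub>v del_col B k)" for l k
  have detB: "det B \<noteq> 0"
    using assms(3)[of "{0..<n}"] assms(1) submatrix_full[OF B] by auto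
  have det: "det (mat_delete B k k) \<noteq> 0" if "k < n" for k
  proof -
    \<comment> \<open>An index other than \<open>k\<close>, which exists because \<open>n \<ge> 2\<close>: for \<open>n = 1\<close> the minor would be empty.\<close>
    have "(if k = 0 then 1 else 0) \<in> {0..<n} - {k}"
      using assms(1) by auto
    then show ?thesis
      using assms(3)[of "{0..<n} - {k}"] submatrix_remove_index[OF B that] by fastforce
  qed
  have s: "schur_del B k \<noteq> 0" if "k < n" for k
    by (rule schur_del_nonzero[OF B detB det[OF that] that])
  have diag: "elim_vec B l $ l = 1" and offdiag: "k \<noteq> l \<Longrightarrow> elim_vec B k $ l = - q l k"
    if "l < n" for l k
    using B that by (simp_all add: elim_vec_def q_def)
  have row: "B $$ (l, m) / schur_del B l - (\<Sum>k \<in> {0..<n} - {l}. B $$ (k, m) * q l k / schur_del B k)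
      = (if l = m then 1 else 0)" if l: "l < n" and m: "m < n" for l m
  proof -
    have "(\<Sum>k \<in> {0..<n} - {l}. elim_vec B k $ l / schur_del B k * B $$ (k, m)) =
        (\<Sum>k \<in> {0..<n} - {l}. - (B $$ (k, m) * q l k / schur_del B k))"
      by (rule sum.cong) (auto simp: offdiag[OF l])
    then show ?thesis
      using left_inverse_entries[OF B detB det l m] l
      by (simp add: sum.remove[of "{0..<n}" l] diag sum_negf)
  qed
  show ?thesis
    unfolding q_def[symmetric]
  proof (intro conjI allI impI)
    fix m assume m: "m < n"
    have "del_row B m \<bullet> (del_inverse B m *\<^sub>v del_col B m) = B $$ (m, m) - schur_del B m"
      by (simp add: schur_del_def)
    then have "del_row B m \<bullet> (del_inverse B m *\<^sub>v del_col B m) / schur_del B m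
        = B $$ (m, m) / schur_del B m - 1"
      using s[OF m] by (simp add: diff_divide_distrib)
    then show "del_row B m \<bullet> (del_inverse B m *\<^sub>v del_col B m) / schur_del B m
        = (\<Sum>l \<in> {0..<n} - {m}. B $$ (l, m) * q m l / schur_del B l)"
      using row[OF m m] by simp
  next
    fix l m assume l: "l < n" and m: "m < n" and lm: "l \<noteq> m"
    have "{0..<n} - {l} - {m} = {0..<n} - {l, m}"
      by auto
    then have "(\<Sum>k \<in> {0..<n} - {l}. B $$ (k, m) * q l k / schur_del B k) =
        B $$ (m, m) * q l m / schur_del B m
          + (\<Sum>k \<in> {0..<n} - {l, m}. B $$ (k, m) * q l k / schur_del B k)"
      using m lm by (simp add: sum.remove[of "{0..<n} - {l}" m])
    then show "- (B $$ (m, m) * q l m / schur_del B m) =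
        - (B $$ (l, m) / schur_del B l)
          + (\<Sum>k \<in> {0..<n} - {l, m}. B $$ (k, m) * q l k / schur_del B k)"
      using row[OF l m] lm by simp
  qed
qed

end
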